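(* Let $I\subset\mathbb R$ be an interval of length $|I|$. Consider $S(t)\in\mathbb R^{d\times d}_{spd}$, $t\in I$, with $\operatorname{rank}(S(t))\le r<d$ and $\lambda_r(S(t))\ge\underline\lambda_r\ge 0$ for all $t\in I$. Then $$\lambda_{r+1}\Big(\frac1{|I|}\int_I S(t)\,dt\Big)\le \Big(\frac{2}{\underline\lambda_r}\Delta_2(S,I)^2\Big)\wedge \Delta_1(S,I),$$ where, for $1\le p<\infty$, $$\Delta_p(S,I):=\Big(\frac1{|I|^2}\int_{I\times I}\|S(s)-S(t)\|^p\,dt\,ds\Big)^{1/p}.$$
   Context: $\mathbb R^{d\times d}_{spd}$ is the set of symmetric positive semi-definite real $d\times d$ matrices; $\lambda_1(S)\ge\dots\ge\lambda_d(S)$ are the ordered eigenvalues (with multiplicities) of a symmetric matrix $S$; $\|\cdot\|$ is the spectral norm; $a\wedge b=\min(a,b)$. The map $t\mapsto S(t)$ is measurable and integrable on the bounded interval $I$ of positive length. For $\underline\lambda_r=0$ the first term in the minimum is read as $+\infty$. *)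

theory Defs
  imports "HOL-Analysis.Analysis" "HOL-Computational_Algebra.Polynomial"
begin

definition spd :: "real ^ 'd ^ 'd \<Rightarrow> bool" where
  "spd A \<longleftrightarrow> transpose A = A \<and> (\<forall>x. 0 \<le> x \<bullet> (A *v x))"

definition charpoly :: "real ^ 'd ^ 'd \<Rightarrow> real poly" where
  "charpoly A = det (\<chi> i j. (if i = j then [:0, 1:] else 0) - [:A $ i $ j:])"

text \<open>The real eigenvalues with algebraic multiplicity, in decreasing order. For a symmetric
  matrix the list has length \<open>CARD('d)\<close>.\<close>

definition eigenvalue_list :: "real ^ 'd ^ 'd \<Rightarrow> real list" where
  "eigenvalue_list A = rev (sorted_list_of_multiset (proots (charpoly A)))"

text \<open>The \<open>k\<close>-th largest eigenvalue, counted from \<open>k = 1\<close>. Meaningful only for symmetric \<open>A\<close> and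
  \<open>1 \<le> k \<le> CARD('d)\<close>; other values of \<open>k\<close> are junk.\<close>

definition eigval :: "nat \<Rightarrow> real ^ 'd ^ 'd \<Rightarrow> real" where
  "eigval k A = eigenvalue_list A ! (k - 1)"

definition spectral_norm :: "real ^ 'd ^ 'd \<Rightarrow> real" where
  "spectral_norm A = onorm ((*v) A)"

definition ennreal_powr :: "ennreal \<Rightarrow> real \<Rightarrow> ennreal" where
  "ennreal_powr x a = (if x = \<infinity> then \<infinity> else ennreal (enn2real x powr a))"

definition interval_mean :: "(real \<Rightarrow> real ^ 'd ^ 'd) \<Rightarrow> real set \<Rightarrow> real ^ 'd ^ 'd" where
  "interval_mean S I = (1 / measure lebesgue I) *\<^sub>R (LINT t:I|lebesgue. S t)"

text \<open>The value is an extended real, because an integrable \<open>S\<close> need not be \<open>p\<close>-integrable for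
  \<open>p > 1\<close>. Intended for \<open>1 \<le> p\<close> and \<open>0 < measure lebesgue I\<close>.\<close>

definition Delta :: "real \<Rightarrow> (real \<Rightarrow> real ^ 'd ^ 'd) \<Rightarrow> real set \<Rightarrow> ennreal" where
  "Delta p S I = ennreal_powr
     (ennreal (1 / (measure lebesgue I)\<^sup>2) *
       (\<integral>\<^sup>+ st \<in> I \<times> I. ennreal (spectral_norm (S (fst st) - S (snd st)) powr p)
          \<partial>(lebesgue \<Otimes>\<^sub>M lebesgue)))
     (1 / p)"

end

theory Submission
  imports Defs
begin

text \<open>Fix \<open>s \<in> I\<close> and let \<open>M\<close> be the mean of \<open>S\<close>. The kernel of \<open>S(s)\<close> has dimension at least
  \<open>CARD('d) - r\<close>, so it contains a unit vector \<open>x\<close> from the span of the top \<open>r + 1\<close> eigenvectors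
  of \<open>M\<close>, and \<open>\<lambda>\<^sub>r\<^sub>+\<^sub>1(M) \<le> x \<bullet> M x\<close>, which is the mean of \<open>x \<bullet> S(t) x\<close> over \<open>t\<close>. As
  \<open>S(t) x = (S(t) - S(s)) x\<close>, the integrand is at most \<open>\<parallel>S(t) - S(s)\<parallel>\<close>. If
  \<open>lr > 0\<close>, then every nonzero eigenvalue of \<open>S(t)\<close> is at least \<open>lr\<close>, so also
  \<open>lr (x \<bullet> S(t) x) \<le> \<parallel>S(t) x\<parallel>\<^sup>2 \<le> \<parallel>S(t) - S(s)\<parallel>\<^sup>2\<close>. Averaging over \<open>s\<close> gives both bounds, the
  second one even without the factor 2.\<close>

section \<open>Spectral theorem for symmetric matrices\<close>

text \<open>Induction on \<open>dim V\<close>: a maximiser of the Rayleigh quotient on the unit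
  sphere of \<open>V\<close> is an eigenvector, and by self-adjointness its orthogonal complement in
  \<open>V\<close> is again invariant. Working with invariant subspaces lets the induction
  hypothesis apply to that complement.\<close>

lemma self_adjoint_orthonormal_eigenvectors:
  fixes f :: "'a::euclidean_space \<Rightarrow> 'a"
  assumes "linear f" and sa: "\<And>x y. f x \<bullet> y = x \<bullet> f y"
    and "subspace V" and "f ` V \<subseteq> V"
  shows "\<exists>B. B \<subseteq> V \<and> span B = V \<and> pairwise orthogonal B
    \<and> (\<forall>b\<in>B. norm b = 1 \<and> (\<exists>c. f b = c *\<^sub>R b))"
  using assms(3,4)
proof (induction "dim V" arbitrary: V rule: less_induct)
  case less
  show ?case
  proof (cases "V = {0}")
    case True
    then show ?thesis by (intro exI[of _ "{}"]) auto
  next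
    case False
    interpret linear f by fact
    have closed: "closed V" using less.prems closed_subspace by blast
    obtain w where w: "w \<in> V" "w \<noteq> 0" using False less.prems subspace_0 by blast
    have "compact (sphere 0 1 \<inter> V)" using closed by (simp add: compact_Int_closed)
    moreover have "w /\<^sub>R norm w \<in> sphere 0 1 \<inter> V"
      using w less.prems by (auto simp: subspace_mul)
    moreover have "continuous_on (sphere 0 1 \<inter> V) (\<lambda>x. x \<bullet> f x)"
      using linear_continuous_on[of f] linear_axioms
      by (intro continuous_intros) (simp_all add: linear_conv_bounded_linear)
    ultimately obtain v where v: "v \<in> V" "norm v = 1"
      and max: "\<And>x. x \<in> V \<Longrightarrow> norm x = 1 \<Longrightarrow> x \<bullet> f x \<le> v \<bullet> f v"
      using continuous_attains_sup[of "sphere 0 1 \<inter> V" "\<lambda>x. x \<bullet> f x"] by fastforce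
    txt \<open>The maximiser \<open>v\<close> of the Rayleigh quotient is an eigenvector: \<open>g \<ge> 0\<close> vanishes at \<open>v\<close>, so its
      derivative there in the direction of the residual \<open>u\<close>, which is \<open>2 (u \<bullet> u)\<close>, is zero.\<close>
    define m where "m = v \<bullet> f v"
    define u where "u = m *\<^sub>R v - f v"
    have u: "u \<in> V"
      using v less.prems by (auto simp: u_def intro!: subspace_diff subspace_mul)
    define g where "g x = m * (x \<bullet> x) - x \<bullet> f x" for x
    have g_nonneg: "0 \<le> g x" if "x \<in> V" for x
    proof (cases "x = 0")
      case False
      let ?y = "x /\<^sub>R norm x"
      have "?y \<bullet> f ?y \<le> m"
        unfolding m_def using that False less.prems by (intro max) (auto simp: subspace_mul)
      moreover have "?y \<bullet> f ?y = (x \<bullet> f x) / (x \<bullet> x)"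
        by (simp add: scale dot_square_norm power2_eq_square divide_simps)
      ultimately have "(x \<bullet> f x) / (x \<bullet> x) \<le> m" by simp
      then show ?thesis
        using False by (simp add: g_def pos_divide_le_eq)
    qed (simp add: g_def)
    have g_line: "g (v + t *\<^sub>R u) = 2 * t * (u \<bullet> u) + t\<^sup>2 * g u" for t
    proof -
      have "f v \<bullet> u = u \<bullet> f v" "v \<bullet> f u = u \<bullet> f v" "v \<bullet> u = u \<bullet> v"
        using sa[of v u] by (simp_all add: inner_commute)
      then have "g (v + t *\<^sub>R u) = g v + 2 * t * (m * (u \<bullet> v) - u \<bullet> f v) + t\<^sup>2 * g u"
        by (simp add: g_def add scale inner_add_left inner_add_right algebra_simps power2_eq_square)
      moreover have "m * (u \<bullet> v) - u \<bullet> f v = u \<bullet> u"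
        by (subst (4) u_def) (simp add: inner_diff_right)
      moreover have "g v = 0" using v by (simp add: g_def m_def dot_square_norm)
      ultimately show ?thesis by simp
    qed
    have "u \<bullet> u = 0"
    proof (rule ccontr)
      assume "u \<bullet> u \<noteq> 0"
      then have pos: "u \<bullet> u > 0" using inner_ge_zero[of u] by linarith
      have gu: "0 \<le> g u" using u g_nonneg by blast
      \<comment> \<open>A negative step so small that the linear term in \<open>g_line\<close>
        outweighs the quadratic one; the \<open>+ 1\<close> keeps the denominator positive when
        \<open>g u = 0\<close>.\<close>
      define t where "t = - (u \<bullet> u) / (g u + 1)"
      have "t < 0" using pos gu by (simp add: t_def field_simps)
      have "t * g u \<ge> - (u \<bullet> u)"
        using pos gu by (simp add: t_def field_simps)
      then have "2 * (u \<bullet> u) + t * g u > 0" using pos by linarith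
      then have "t * (2 * (u \<bullet> u) + t * g u) < 0" using \<open>t < 0\<close> by (simp add: mult_less_0_iff)
      moreover have "0 \<le> g (v + t *\<^sub>R u)"
        using v u less.prems by (intro g_nonneg subspace_add subspace_mul) auto
      ultimately show False by (simp add: g_line algebra_simps power2_eq_square)
    qed
    then have fv: "f v = m *\<^sub>R v" by (simp add: u_def)
    define W where "W = {x \<in> V. v \<bullet> x = 0}"
    have "subspace W"
      using less.prems(1) by (auto simp: W_def subspace_def inner_add_right)
    moreover have "f ` W \<subseteq> W"
      using less.prems(2) fv by (auto simp: W_def simp flip: sa)
    moreover have "dim W < dim V"
    proof (rule dim_psubset)
      have "v \<notin> W" using v by (auto simp: W_def)
      moreover have "W \<subseteq> V" by (auto simp: W_def)
      ultimately have "W \<subset> V" using v by blast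
      then show "span W \<subset> span V"
        using \<open>subspace W\<close> less.prems(1) by (simp add: span_eq_iff[THEN iffD2])
    qed
    ultimately obtain B where B: "B \<subseteq> W" "span B = W" "pairwise orthogonal B"
      "\<forall>b\<in>B. norm b = 1 \<and> (\<exists>c. f b = c *\<^sub>R b)"
      using less.hyps by blast
    have "V \<subseteq> span (insert v B)"
    proof
      fix x assume "x \<in> V"
      have "x - (v \<bullet> x) *\<^sub>R v \<in> W"
        using \<open>x \<in> V\<close> v less.prems(1)
        by (auto simp: W_def inner_diff_right dot_square_norm intro!: subspace_diff subspace_mul)
      then show "x \<in> span (insert v B)"
        using B(2) by (auto simp: span_insert)
    qed
    moreover have "insert v B \<subseteq> V" using v B(1) by (auto simp: W_def)
    ultimately have "span (insert v B) = V"
      using less.prems(1) by (metis span_minimal subset_antisym)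
    moreover have "pairwise orthogonal (insert v B)"
      using B(1,3) by (auto simp: pairwise_insert orthogonal_def W_def inner_commute)
    ultimately show ?thesis
      using \<open>insert v B \<subseteq> V\<close> B(4) v(2) fv by (intro exI[of _ "insert v B"]) blast
  qed
qed

lemma symmetric_matrix_inner:
  fixes A :: "real ^ 'd ^ 'd"
  assumes "transpose A = A"
  shows "(A *v x) \<bullet> y = x \<bullet> (A *v y)"
  by (metis assms dot_lmul_matrix vector_transpose_matrix)

text \<open>Indexing by \<open>'d\<close> itself makes the eigenvectors the columns of a square
  matrix. The values \<open>lam i\<close> come in no particular order.\<close>

lemma symmetric_matrix_eigenbasis:
  fixes A :: "real ^ 'd ^ 'd"
  assumes "transpose A = A"
  obtains v :: "'d \<Rightarrow> real ^ 'd" and lam :: "'d \<Rightarrow> real"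
  where "\<And>i j. v i \<bullet> v j = (if i = j then 1 else 0)" and "\<And>i. A *v v i = lam i *\<^sub>R v i"
proof -
  obtain B where B: "span B = UNIV" "pairwise orthogonal B"
    "\<forall>b\<in>B. norm b = 1 \<and> (\<exists>c. A *v b = c *\<^sub>R b)"
    using self_adjoint_orthonormal_eigenvectors[of "(*v) A" UNIV] symmetric_matrix_inner[OF assms]
    by auto
  have "0 \<notin> B" using B(3) by force
  then have "independent B" using B(2) pairwise_orthogonal_independent by blast
  then have "finite B" "card B = CARD('d)"
    using B(1) independent_bound dim_eq_card[of B UNIV] by (auto simp: dim_UNIV)
  then obtain v where v: "bij_betw v (UNIV :: 'd set) B"
    using finite_same_card_bij[of "UNIV :: 'd set" B] by auto
  then have vB: "v i \<in> B" for i by (auto simp: bij_betw_def)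
  have "\<exists>c. A *v v i = c *\<^sub>R v i" for i
    using B(3) vB by blast
  then obtain lam where "A *v v i = lam i *\<^sub>R v i" for i
    by metis
  moreover have "v i \<bullet> v j = (if i = j then 1 else 0)" for i j
  proof (cases "i = j")
    case True
    then show ?thesis using B(3) vB by (simp add: dot_square_norm)
  next
    case False
    then have "v i \<noteq> v j" using v by (auto simp: bij_betw_def inj_on_def)
    then show ?thesis using B(2) vB False by (auto simp: pairwise_def orthogonal_def)
  qed
  ultimately show thesis using that by blast
qed

section \<open>Characteristic polynomial and ordered eigenvalues\<close>

definition column_matrix :: "('d \<Rightarrow> real ^ 'd) \<Rightarrow> real ^ 'd ^ 'd" where
  "column_matrix v = (\<chi> i j. v j $ i)"

lemma column_column_matrix [simp]: "column j (column_matrix v) = v j"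
  by (simp add: column_matrix_def column_def)

lemma orthogonal_column_matrix:
  assumes "\<And>i j. v i \<bullet> v j = (if i = j then 1 else 0)"
  shows "orthogonal_matrix (column_matrix v)"
  by (simp add: orthogonal_matrix matrix_mult_transpose_dot_column assms mat_def)

text \<open>The square matrix with columns \<open>v i\<close> is orthogonal, so its transpose is
  also a right inverse; this is completeness of the family.\<close>

lemma orthonormal_expansion:
  fixes v :: "'d \<Rightarrow> real ^ 'd"
  assumes "\<And>i j. v i \<bullet> v j = (if i = j then 1 else 0)"
  shows "x = (\<Sum>i\<in>UNIV. (v i \<bullet> x) *\<^sub>R v i)"
proof -
  let ?Q = "column_matrix v"
  have "(transpose ?Q *v x) $ i = v i \<bullet> x" for i
    by (simp add: matrix_vector_mult_def transpose_def column_matrix_def inner_vec_def)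
  moreover have "x = ?Q *v (transpose ?Q *v x)"
    using orthogonal_column_matrix[OF assms]
    by (simp add: matrix_vector_mul_assoc orthogonal_matrix_def del: transpose_matrix_vector)
  ultimately show ?thesis
    by (simp add: matrix_mult_sum scalar_mult_eq_scaleR)
qed

lemma mat_mult_vector: "mat c *v x = c *\<^sub>R x" for x :: "real ^ 'd"
  by (simp add: vec_eq_iff matrix_vector_mult_def mat_def if_distrib[of "\<lambda>y. y * _"] cong: if_cong)

text \<open>Evaluation at \<open>x\<close> is a ring homomorphism, hence passes through the
  expansion of the determinant.\<close>

lemma poly_charpoly:
  fixes A :: "real ^ 'd ^ 'd"
  shows "poly (charpoly A) x = det (mat x - A)"
  by (simp add: charpoly_def det_def poly_sum poly_prod mat_def if_distrib[of "\<lambda>p. poly p x"]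
      cong: if_cong)

text \<open>Ties the algebraic multiplicities behind \<open>eigenvalue_list\<close> to the
  eigenbasis. With \<open>Q\<close> the matrix of eigenvectors and \<open>D\<close> the diagonal
  matrix of the \<open>x - lam i\<close>, \<open>(mat x - A) ** Q = Q ** D\<close>; taking
  determinants cancels \<open>det Q\<close>.\<close>

lemma charpoly_eq_prod:
  fixes A :: "real ^ 'd ^ 'd" and v :: "'d \<Rightarrow> real ^ 'd"
  assumes v: "\<And>i j. v i \<bullet> v j = (if i = j then 1 else 0)"
    and A: "\<And>i. A *v v i = lam i *\<^sub>R v i"
  shows "charpoly A = (\<Prod>i\<in>UNIV. [:- lam i, 1:])"
proof -
  let ?Q = "column_matrix v"
  have "poly (charpoly A) x = poly (\<Prod>i\<in>UNIV. [:- lam i, 1:]) x" for x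
  proof -
    define D :: "real ^ 'd ^ 'd" where "D = (\<chi> i j. if i = j then x - lam i else 0)"
    have "column j ((mat x - A) ** ?Q) = column j (?Q ** D)" for j
    proof -
      have "column j ((mat x - A) ** ?Q) = (mat x - A) *v v j"
        by (simp add: vec_eq_iff column_def matrix_matrix_mult_def matrix_vector_mult_def column_matrix_def)
      also have "\<dots> = (x - lam j) *\<^sub>R v j"
        by (simp add: matrix_vector_mult_diff_rdistrib mat_mult_vector A algebra_simps)
      also have "\<dots> = column j (?Q ** D)"
        by (simp add: vec_eq_iff column_def matrix_matrix_mult_def column_matrix_def D_def
            if_distrib[of "\<lambda>y. _ * y"] mult.commute cong: if_cong)
      finally show ?thesis .
    qed
    then have "(mat x - A) ** ?Q = ?Q ** D"
      by (auto simp: vec_eq_iff column_def)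
    then have "det (mat x - A) * det ?Q = det ?Q * det D"
      by (metis det_mul)
    moreover have "det ?Q \<noteq> 0"
      using det_orthogonal_matrix[OF orthogonal_column_matrix[OF v]] by auto
    ultimately have "det (mat x - A) = det D" by simp
    also have "\<dots> = (\<Prod>i\<in>UNIV. x - lam i)"
      by (subst det_diagonal) (auto simp: D_def)
    finally show ?thesis by (simp add: poly_charpoly poly_prod)
  qed
  then show ?thesis by (simp add: poly_eq_poly_eq_iff[symmetric] fun_eq_iff)
qed

text \<open>The roots with multiplicity are the multiset of all \<open>lam i\<close>. Counting
  indices replaces sorting the eigenbasis, and counts repeated eigenvalues correctly.\<close>

lemma le_card_eigval_le:
  fixes A :: "real ^ 'd ^ 'd" and lam :: "'d \<Rightarrow> real"
  assumes p: "charpoly A = (\<Prod>i\<in>UNIV. [:- lam i, 1:])"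
    and k: "1 \<le> k" "k \<le> CARD('d)"
  shows "k \<le> card {i. eigval k A \<le> lam i}"
proof -
  define L where "L = eigenvalue_list A"
  define c where "c = eigval k A"
  have proots: "proots (charpoly A) = image_mset lam (mset_set UNIV)"
    unfolding p by (subst proots_prod) (simp_all add: sum_unfold_sum_mset multiset.map_comp o_def)
  have mset: "mset L = image_mset lam (mset_set UNIV)"
    by (simp add: L_def eigenvalue_list_def proots)
  then have len: "length L = CARD('d)"
    by (simp flip: size_mset)
  \<comment> \<open>\<open>c\<close> sits at position \<open>k - 1\<close> of a decreasing list, so
    the \<open>k\<close> positions \<open>0, ..., k - 1\<close> all carry values at least
    \<open>c\<close>.\<close>
  have "c \<le> L ! j" if "j < k" for j
    using that k len unfolding c_def eigval_def L_def[symmetric]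
    by (intro sorted_rev_nth_mono) (auto simp: L_def eigenvalue_list_def)
  then have "{..<k} \<subseteq> {j. j < length L \<and> c \<le> L ! j}"
    using k len by auto
  then have "k \<le> length (filter (\<lambda>x. c \<le> x) L)"
    unfolding length_filter_conv_card
    by (metis (no_types, lifting) card_lessThan card_mono finite_nat_set_iff_bounded mem_Collect_eq)
  also have "\<dots> = size (filter_mset (\<lambda>x. c \<le> x) (mset L))"
    by (simp flip: mset_filter)
  also have "\<dots> = card {i. c \<le> lam i}"
    by (simp add: mset filter_mset_image_mset)
  finally show ?thesis by (simp add: c_def)
qed

lemma symmetric_matrix_spectral:
  fixes A :: "real ^ 'd ^ 'd"
  assumes "transpose A = A"
  obtains v :: "'d \<Rightarrow> real ^ 'd" and lam :: "'d \<Rightarrow> real"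
  where "\<And>i j. v i \<bullet> v j = (if i = j then 1 else 0)" and "\<And>i. A *v v i = lam i *\<^sub>R v i"
    and "\<And>k. 1 \<le> k \<Longrightarrow> k \<le> CARD('d) \<Longrightarrow> k \<le> card {i. eigval k A \<le> lam i}"
proof -
  obtain v :: "'d \<Rightarrow> real ^ 'd" and lam :: "'d \<Rightarrow> real"
    where v: "\<And>i j. v i \<bullet> v j = (if i = j then 1 else 0)" and A: "\<And>i. A *v v i = lam i *\<^sub>R v i"
    using symmetric_matrix_eigenbasis[OF assms] by blast
  show thesis
    using le_card_eigval_le[OF charpoly_eq_prod[OF v A]] by (rule that[OF v A])
qed

section \<open>Quadratic forms in an eigenbasis and a min-max bound\<close>

lemma orthonormal_parseval:
  fixes v :: "'d \<Rightarrow> real ^ 'd"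
  assumes v: "\<And>i j. v i \<bullet> v j = (if i = j then 1 else 0)"
  shows "x \<bullet> y = (\<Sum>i\<in>UNIV. (v i \<bullet> x) * (v i \<bullet> y))"
  by (subst orthonormal_expansion[OF v, of x]) (simp add: inner_sum_left)

lemma quadratic_form_eigenbasis:
  fixes A :: "real ^ 'd ^ 'd" and v :: "'d \<Rightarrow> real ^ 'd"
  assumes sym: "transpose A = A"
    and v: "\<And>i j. v i \<bullet> v j = (if i = j then 1 else 0)"
    and A: "\<And>i. A *v v i = lam i *\<^sub>R v i"
  shows "x \<bullet> (A *v x) = (\<Sum>i\<in>UNIV. lam i * (v i \<bullet> x)\<^sup>2)"
    and "(norm (A *v x))\<^sup>2 = (\<Sum>i\<in>UNIV. (lam i)\<^sup>2 * (v i \<bullet> x)\<^sup>2)"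
proof -
  have "v i \<bullet> (A *v x) = lam i * (v i \<bullet> x)" for i
    using symmetric_matrix_inner[OF sym, of "v i" x] by (simp add: A)
  then show "x \<bullet> (A *v x) = (\<Sum>i\<in>UNIV. lam i * (v i \<bullet> x)\<^sup>2)"
    and "(norm (A *v x))\<^sup>2 = (\<Sum>i\<in>UNIV. (lam i)\<^sup>2 * (v i \<bullet> x)\<^sup>2)"
    unfolding power2_norm_eq_inner
      orthonormal_parseval[OF v, of x "A *v x"] orthonormal_parseval[OF v, of "A *v x" "A *v x"]
    by (simp_all add: power2_eq_square algebra_simps)
qed

lemma dim_span_orthonormal:
  fixes v :: "'d \<Rightarrow> real ^ 'd"
  assumes v: "\<And>i j. v i \<bullet> v j = (if i = j then 1 else 0)"
  shows "dim (span (v ` J)) = card J"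
proof -
  have "inj_on v J"
    by (rule inj_onI) (metis v zero_neq_one)
  moreover have "independent (v ` J)"
    using v by (intro pairwise_orthogonal_independent)
      (auto simp: pairwise_def orthogonal_def, metis inner_zero_left zero_neq_one)
  ultimately show ?thesis
    by (simp add: dim_eq_card_independent card_image)
qed

text \<open>One half of Courant-Fischer. The eigenvectors with eigenvalue at least
  \<open>eigval k A\<close> span a space \<open>W\<close> of dimension at least \<open>k\<close>,
  which must meet \<open>V\<close> nontrivially by the dimension formula; on unit vectors of
  \<open>W\<close> the quadratic form is at least \<open>eigval k A\<close>.\<close>

lemma eigval_le_quadratic_form:
  fixes A :: "real ^ 'd ^ 'd"
  assumes sym: "transpose A = A" and V: "subspace V" and k: "1 \<le> k" "k \<le> CARD('d)"
    and dim: "CARD('d) < dim V + k"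
  obtains x where "x \<in> V" "norm x = 1" "eigval k A \<le> x \<bullet> (A *v x)"
proof -
  obtain v :: "'d \<Rightarrow> real ^ 'd" and lam :: "'d \<Rightarrow> real"
    where v: "\<And>i j. v i \<bullet> v j = (if i = j then 1 else 0)"
    and A: "\<And>i. A *v v i = lam i *\<^sub>R v i"
    and "\<And>k. 1 \<le> k \<Longrightarrow> k \<le> CARD('d) \<Longrightarrow> k \<le> card {i. eigval k A \<le> lam i}"
    using symmetric_matrix_spectral[OF sym] by blast
  then have card: "k \<le> card {i. eigval k A \<le> lam i}" using k by blast
  define J where "J = {i. eigval k A \<le> lam i}"
  define W where "W = span (v ` J)"
  have "dim {x + y |x y. x \<in> V \<and> y \<in> W} + dim (V \<inter> W) = dim V + dim W"
    using V by (intro dim_sums_Int) (auto simp: W_def)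
  moreover have "dim {x + y |x y. x \<in> V \<and> y \<in> W} \<le> CARD('d)"
    using dim_subset_UNIV[of "{x + y |x y. x \<in> V \<and> y \<in> W}"] by simp
  moreover have "dim W = card J" unfolding W_def by (rule dim_span_orthonormal[OF v])
  moreover have "k \<le> card J" using card by (simp add: J_def)
  ultimately have "dim (V \<inter> W) \<noteq> 0" using dim by linarith
  then obtain y where y: "y \<in> V" "y \<in> W" "y \<noteq> 0" by auto
  define x where "x = y /\<^sub>R norm y"
  have x: "x \<in> V" "x \<in> W" "norm x = 1"
    using y V by (auto simp: x_def W_def intro: subspace_mul span_mul)
  have zero: "v i \<bullet> x = 0" if "i \<notin> J" for i
    using \<open>x \<in> W\<close> unfolding W_def
  proof (induction rule: span_induct_alt)
    case (step c b z)
    then obtain j where "j \<in> J" "b = v j" by blast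
    moreover from this have "v i \<bullet> b = 0" using that v[of i j] by auto
    ultimately show ?case using step by (simp add: inner_add_right)
  qed simp
  have "eigval k A = eigval k A * (x \<bullet> x)" using x by (simp add: dot_square_norm)
  also have "\<dots> = (\<Sum>i\<in>UNIV. eigval k A * (v i \<bullet> x)\<^sup>2)"
    by (simp add: orthonormal_parseval[OF v, of x x] sum_distrib_left power2_eq_square)
  \<comment> \<open>Termwise: for \<open>i\<close> in \<open>J\<close> by the choice of
    \<open>J\<close>, and otherwise both sides vanish by \<open>zero\<close>.\<close>
  also have "\<dots> \<le> (\<Sum>i\<in>UNIV. lam i * (v i \<bullet> x)\<^sup>2)"
  proof (rule sum_mono)
    show "eigval k A * (v i \<bullet> x)\<^sup>2 \<le> lam i * (v i \<bullet> x)\<^sup>2" for i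
      by (cases "i \<in> J") (auto simp: J_def[symmetric] zero, auto simp: J_def intro: mult_right_mono)
  qed
  also have "\<dots> = x \<bullet> (A *v x)" by (simp add: quadratic_form_eigenbasis(1)[OF sym v A])
  finally show thesis using that x by blast
qed

section \<open>Rank, kernel and the smallest nonzero eigenvalue\<close>

text \<open>The kernel is the orthogonal complement of the row space, whose dimension is the
  rank.\<close>

lemma dim_matrix_kernel:
  fixes A :: "real ^ 'd ^ 'e"
  shows "subspace {x. A *v x = 0}" and "dim {x. A *v x = 0} + rank A = CARD('d)"
proof -
  have eq: "{x. A *v x = 0} = {y \<in> UNIV. \<forall>x \<in> span (rows A). orthogonal x y}"
  proof -
    have "A *v y = 0 \<longleftrightarrow> (\<forall>x \<in> rows A. orthogonal x y)" for y
      by (auto simp: rows_def vec_eq_iff[of "A *v y"] matrix_vector_mul_component row_def orthogonal_def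
          vec_lambda_eta)
    moreover have "(\<forall>x \<in> rows A. orthogonal x y) \<longleftrightarrow> (\<forall>x \<in> span (rows A). orthogonal x y)" for y
      by (meson orthogonal_commute orthogonal_to_span span_base)
    ultimately show ?thesis by simp
  qed
  show "dim {x. A *v x = 0} + rank A = CARD('d)"
    using dim_subspace_orthogonal_to_vectors[of "span (rows A)" UNIV]
    by (simp add: eq row_rank_def)
  show "subspace {x. A *v x = 0}"
    by (auto simp: subspace_def matrix_vector_right_distrib matrix_vector_mult_scaleR)
qed

text \<open>In eigencoordinates the claim reduces to
  \<open>lr * lam i \<le> (lam i)\<^sup>2\<close>, which holds once each \<open>lam i\<close> is
  zero or at least \<open>lr\<close>.\<close>

lemma spd_quadratic_form_le:
  fixes B :: "real ^ 'd ^ 'd"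
  assumes spd: "spd B" and rank: "rank B \<le> r" and r: "1 \<le> r" "r \<le> CARD('d)"
    and lr: "lr \<le> eigval r B"
  shows "lr * (x \<bullet> (B *v x)) \<le> (norm (B *v x))\<^sup>2"
proof -
  have sym: "transpose B = B" and pos: "\<And>y. 0 \<le> y \<bullet> (B *v y)" using spd by (auto simp: spd_def)
  obtain v :: "'d \<Rightarrow> real ^ 'd" and lam :: "'d \<Rightarrow> real"
    where v: "\<And>i j. v i \<bullet> v j = (if i = j then 1 else 0)"
    and B: "\<And>i. B *v v i = lam i *\<^sub>R v i"
    and "\<And>k. 1 \<le> k \<Longrightarrow> k \<le> CARD('d) \<Longrightarrow> k \<le> card {i. eigval k B \<le> lam i}"
    using symmetric_matrix_spectral[OF sym] by blast
  then have card: "r \<le> card {i. eigval r B \<le> lam i}" using r by blast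
  have lam0: "0 \<le> lam i" for i using pos[of "v i"] by (simp add: B v)
  have "lr * lam i \<le> (lam i)\<^sup>2" for i
  proof (cases "lr \<le> lam i \<or> lam i = 0")
    case True
    then show ?thesis using lam0[of i] by (auto simp: power2_eq_square intro: mult_right_mono)
  next
    \<comment> \<open>Now \<open>0 < lam i < lr\<close>. Besides \<open>i\<close> there are at least
      \<open>r\<close> indices whose eigenvalue is at least \<open>eigval r B \<ge> lr\<close>, so
      at least \<open>r + 1\<close> eigenvalues are nonzero. Their eigenvectors lie in the range of
      \<open>B\<close>, contradicting the bound on the rank.\<close>
    case False
    let ?J = "{j. lam j \<noteq> 0}"
    have "v j \<in> range ((*v) B)" if "lam j \<noteq> 0" for j
    proof
      show "v j = B *v (v j /\<^sub>R lam j)" using that by (simp add: B matrix_vector_mult_scaleR)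
    qed simp
    then have "span (v ` ?J) \<subseteq> range ((*v) B)"
      by (intro span_minimal) (auto simp: linear_subspace_image)
    then have "card ?J \<le> rank B"
      by (metis dim_span_orthonormal[OF v] dim_subset rank_dim_range)
    moreover have "insert i {j. eigval r B \<le> lam j} \<subseteq> ?J"
      using False lr lam0[of i] by auto
    then have "card (insert i {j. eigval r B \<le> lam j}) \<le> card ?J"
      by (intro card_mono) auto
    moreover have "card (insert i {j. eigval r B \<le> lam j}) = Suc (card {j. eigval r B \<le> lam j})"
      using False lr by (subst card_insert_disjoint) auto
    ultimately show ?thesis using card rank by linarith
  qed
  then have "(\<Sum>i\<in>UNIV. (lr * lam i) * (v i \<bullet> x)\<^sup>2) \<le> (\<Sum>i\<in>UNIV. (lam i)\<^sup>2 * (v i \<bullet> x)\<^sup>2)"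
    by (intro sum_mono mult_right_mono) auto
  then show ?thesis
    by (simp add: quadratic_form_eigenbasis[OF sym v B] sum_distrib_left mult.assoc)
qed

section \<open>Lebesgue measure and the spectral norm\<close>

text \<open>Needed for Tonelli on the product of completed measures; an exhaustion for
  \<open>lborel\<close> also serves its completion.\<close>

lemma sigma_finite_lebesgue: "sigma_finite_measure (lebesgue :: 'a::euclidean_space measure)"
proof
  obtain F :: "nat \<Rightarrow> 'a set" where "range F \<subseteq> sets lborel" "(\<Union>i. F i) = space lborel"
    "\<And>i. emeasure lborel (F i) \<noteq> \<infinity>"
    using lborel.sigma_finite by blast
  then show "\<exists>A. countable A \<and> A \<subseteq> sets lebesgue \<and> \<Union> A = space (lebesgue :: 'a measure)
      \<and> (\<forall>a\<in>A. emeasure lebesgue a \<noteq> \<infinity>)"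
    by (intro exI[of _ "range F"]) auto
qed

lemma spectral_norm_nonneg [simp]: "0 \<le> spectral_norm A"
  by (simp add: spectral_norm_def onorm_pos_le)

lemma norm_mult_le_spectral_norm: "norm (A *v x) \<le> spectral_norm A * norm x"
  by (simp add: spectral_norm_def onorm)

text \<open>A crude entrywise estimate; its only use is as a Lipschitz constant, from which
  measurability of the spectral norm follows.\<close>

lemma spectral_norm_le_norm:
  fixes A :: "real ^ 'd ^ 'd"
  shows "spectral_norm A \<le> real CARD('d) * real CARD('d) * norm A"
  unfolding spectral_norm_def
proof (rule onorm_le_matrix_component)
  show "\<bar>A $ i $ j\<bar> \<le> norm A" for i j
    by (metis Finite_Cartesian_Product.norm_nth_le order_trans real_norm_def)
qed

lemma spectral_norm_triangle: "spectral_norm (A + B) \<le> spectral_norm A + spectral_norm B"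
proof -
  have "(*v) (A + B) = (\<lambda>x. A *v x + B *v x)" by (simp add: fun_eq_iff matrix_vector_mult_add_rdistrib)
  then show ?thesis using onorm_triangle[of "(*v) A" "(*v) B"] by (simp add: spectral_norm_def)
qed

lemma spectral_norm_minus_commute: "spectral_norm (A - B) = spectral_norm (B - A)"
proof -
  have "(*v) (A - B) = (\<lambda>x. - ((B - A) *v x))" by (simp add: fun_eq_iff matrix_vector_mult_diff_rdistrib)
  then show ?thesis using onorm_neg[of "(*v) (B - A)"] by (simp add: spectral_norm_def)
qed

lemma continuous_on_spectral_norm: "continuous_on UNIV (spectral_norm :: real ^ 'd ^ 'd \<Rightarrow> real)"
proof (rule lipschitz_on_continuous_on, rule lipschitz_onI)
  let ?K = "real CARD('d) * real CARD('d)"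
  show "dist (spectral_norm A) (spectral_norm B) \<le> ?K * dist A B" for A B :: "real ^ 'd ^ 'd"
    using spectral_norm_triangle[of "A - B" B] spectral_norm_triangle[of "B - A" A]
      spectral_norm_le_norm[of "A - B"] spectral_norm_minus_commute[of A B]
    by (simp add: dist_norm)
qed simp

lemma borel_measurable_spectral_norm [measurable]:
  "spectral_norm \<in> borel_measurable borel"
  by (intro borel_measurable_continuous_onI continuous_on_spectral_norm)

lemma quadratic_form_le_spectral_norm_diff:
  fixes A B :: "real ^ 'd ^ 'd"
  assumes "norm x = 1" and "A *v x = 0"
  shows "norm (B *v x) \<le> spectral_norm (A - B)" and "x \<bullet> (B *v x) \<le> spectral_norm (A - B)"
proof -
  have "B *v x = (B - A) *v x" using assms by (simp add: matrix_vector_mult_diff_rdistrib)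
  then show le: "norm (B *v x) \<le> spectral_norm (A - B)"
    using norm_mult_le_spectral_norm[of "B - A" x] assms
    by (simp add: spectral_norm_minus_commute)
  have "x \<bullet> (B *v x) \<le> norm x * norm (B *v x)" by (rule norm_cauchy_schwarz)
  then show "x \<bullet> (B *v x) \<le> spectral_norm (A - B)" using le assms by simp
qed

section \<open>Quadratic form and symmetry of the mean matrix\<close>

text \<open>Linearity in the matrix, for fixed \<open>x\<close>, is what lets the quadratic form
  pass through the integral in \<open>interval_mean\<close>.\<close>

lemma bounded_linear_quadratic_form: "bounded_linear (\<lambda>A :: real ^ 'd ^ 'd. x \<bullet> (A *v x))"
  unfolding linear_conv_bounded_linear[symmetric]
  by (rule linearI) (simp_all add: matrix_vector_mult_add_rdistrib inner_add_right
      scaleR_matrix_vector_assoc[symmetric])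

lemma quadratic_form_interval_mean:
  fixes S :: "real \<Rightarrow> real ^ 'd ^ 'd"
  assumes "set_integrable lebesgue I S"
  shows "set_integrable lebesgue I (\<lambda>t. x \<bullet> (S t *v x))"
    and "x \<bullet> (interval_mean S I *v x) = (LINT t:I|lebesgue. x \<bullet> (S t *v x)) / measure lebesgue I"
proof -
  interpret bounded_linear "\<lambda>A :: real ^ 'd ^ 'd. x \<bullet> (A *v x)"
    by (rule bounded_linear_quadratic_form)
  have eq: "indicator I t *\<^sub>R (x \<bullet> (S t *v x)) = x \<bullet> ((indicator I t *\<^sub>R S t) *v x)" for t :: real
    by (simp add: scaleR)
  show "set_integrable lebesgue I (\<lambda>t. x \<bullet> (S t *v x))"
    using integrable_bounded_linear[OF bounded_linear_quadratic_form[of x] assms[unfolded set_integrable_def]]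
    unfolding set_integrable_def eq .
  show "x \<bullet> (interval_mean S I *v x) = (LINT t:I|lebesgue. x \<bullet> (S t *v x)) / measure lebesgue I"
    using integral_bounded_linear[OF bounded_linear_quadratic_form[of x] assms[unfolded set_integrable_def]]
    by (simp add: interval_mean_def set_lebesgue_integral_def eq scaleR)
qed

text \<open>Transposition is bounded linear and so commutes with the integral.\<close>

lemma transpose_interval_mean:
  fixes S :: "real \<Rightarrow> real ^ 'd ^ 'd"
  assumes int: "set_integrable lebesgue I S" and sym: "\<And>t. t \<in> I \<Longrightarrow> transpose (S t) = S t"
  shows "transpose (interval_mean S I) = interval_mean S I"
proof -
  have lin: "bounded_linear (transpose :: real ^ 'd ^ 'd \<Rightarrow> _)"
    unfolding linear_conv_bounded_linear[symmetric]
    by (rule linearI) (simp_all add: transpose_def vec_eq_iff)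
  have "transpose (indicator I t *\<^sub>R S t) = indicator I t *\<^sub>R S t" for t :: real
    using sym[of t] by (auto simp: indicator_def transpose_def vec_eq_iff)
  then have "transpose (LINT t:I|lebesgue. S t) = (LINT t:I|lebesgue. S t)"
    using integral_bounded_linear[OF lin int[unfolded set_integrable_def]]
    by (simp add: set_lebesgue_integral_def)
  then show ?thesis
    by (simp add: interval_mean_def bounded_linear.linear[OF lin] linear_scale)
qed

section \<open>Averaging over pairs of points\<close>

text \<open>Common source of both bounds, with \<open>p = 1\<close>, \<open>c = 1\<close> and with
  \<open>p = 2\<close>, \<open>c = 2 / lr\<close>. It is stated in \<open>ennreal\<close> because
  the double integral may be infinite.\<close>

lemma eigval_interval_mean_le:
  fixes S :: "real \<Rightarrow> real ^ 'd ^ 'd"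
  assumes I: "I \<in> sets lebesgue" "0 < measure lebesgue I"
    and int: "set_integrable lebesgue I S"
    and r: "r < CARD('d)"
    and spd: "\<And>t. t \<in> I \<Longrightarrow> spd (S t)"
    and rank: "\<And>t. t \<in> I \<Longrightarrow> rank (S t) \<le> r"
    and c: "0 \<le> c"
    and bound: "\<And>s t x. s \<in> I \<Longrightarrow> t \<in> I \<Longrightarrow> norm x = 1 \<Longrightarrow> S s *v x = 0
      \<Longrightarrow> x \<bullet> (S t *v x) \<le> c * spectral_norm (S s - S t) powr p"
  shows "ennreal (eigval (r + 1) (interval_mean S I)) \<le> ennreal c * (ennreal (1 / (measure lebesgue I)\<^sup>2) *
       (\<integral>\<^sup>+ st \<in> I \<times> I. ennreal (spectral_norm (S (fst st) - S (snd st)) powr p)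
          \<partial>(lebesgue \<Otimes>\<^sub>M lebesgue)))"
proof -
  interpret sigma_finite_measure "lebesgue :: real measure" by (rule sigma_finite_lebesgue)
  define M where "M = interval_mean S I"
  define lam where "lam = eigval (r + 1) M"
  define l where "l = measure lebesgue I"
  have l: "0 < l" using I by (simp add: l_def)
  \<comment> \<open>An infinite measure would make \<open>measure lebesgue I\<close> zero, by the
    convention of \<open>enn2real\<close>.\<close>
  have emeasure_I: "emeasure lebesgue I = ennreal l"
    using I by (metis emeasure_eq_ennreal_measure enn2real_top l_def less_irrefl measure_def)
  \<comment> \<open>Integrability on \<open>I\<close> controls \<open>S\<close> only there; the
    extension by zero is measurable on the whole line.\<close>
  define S' where "S' t = indicator I t *\<^sub>R S t" for t :: real
  have [measurable]: "S' \<in> borel_measurable lebesgue"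
    using int unfolding S'_def set_integrable_def by (rule borel_measurable_integrable)
  define F where "F s t = ennreal (spectral_norm (S' s - S' t) powr p) * indicator I t * indicator I s" for s t
  have I_meas [measurable]: "I \<in> sets lebesgue" by (rule I)
  have F [measurable]: "(\<lambda>(s, t). F s t) \<in> borel_measurable (lebesgue \<Otimes>\<^sub>M lebesgue)"
    unfolding F_def by measurable
  \<comment> \<open>The kernel vector \<open>x\<close> depends on \<open>s\<close> but is absent
    from this estimate, so integrating over \<open>s\<close> raises no question of a measurable
    choice.\<close>
  have inner_bound: "ennreal (lam * l) * indicator I s \<le> ennreal c * (\<integral>\<^sup>+ t. F s t \<partial>lebesgue)" for s
  proof (cases "s \<in> I")
    case True
    obtain x where x: "S s *v x = 0" "norm x = 1" "lam \<le> x \<bullet> (M *v x)"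
    proof (rule eigval_le_quadratic_form[of M "{x. S s *v x = 0}" "r + 1"])
      show "transpose M = M"
        unfolding M_def using int spd by (intro transpose_interval_mean) (auto simp: spd_def)
      \<comment> \<open>The kernel has dimension at least \<open>CARD('d) - r\<close>; the index
        \<open>r + 1\<close> makes the inequality strict.\<close>
      show "CARD('d) < dim {x. S s *v x = 0} + (r + 1)"
        using dim_matrix_kernel(2)[of "S s"] rank[OF True] by linarith
    qed (use r dim_matrix_kernel(1) in \<open>auto simp: lam_def\<close>)
    have nonneg: "0 \<le> x \<bullet> (S t *v x)" if "t \<in> I" for t
      using spd[OF that] by (simp add: spd_def)
    have "lam * l \<le> (LINT t:I|lebesgue. x \<bullet> (S t *v x))"
      using x(3) l unfolding M_def quadratic_form_interval_mean(2)[OF int] l_def[symmetric]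
      by (simp add: field_simps)
    then have "ennreal (lam * l) \<le> ennreal (LINT t:I|lebesgue. x \<bullet> (S t *v x))"
      by (rule ennreal_leI)
    \<comment> \<open>Positive semi-definiteness on \<open>I\<close> makes the integrand
      nonnegative, so both notions of integral agree.\<close>
    also have "\<dots> = (\<integral>\<^sup>+ t. ennreal (indicator I t *\<^sub>R (x \<bullet> (S t *v x))) \<partial>lebesgue)"
      unfolding set_lebesgue_integral_def
      using quadratic_form_interval_mean(1)[OF int, of x] nonneg
      by (intro nn_integral_eq_integral[symmetric]) (auto simp: set_integrable_def indicator_def)
    also have "\<dots> \<le> (\<integral>\<^sup>+ t. ennreal c * F s t \<partial>lebesgue)"
    proof (rule nn_integral_mono)
      show "ennreal (indicator I t *\<^sub>R (x \<bullet> (S t *v x))) \<le> ennreal c * F s t" for t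
        using bound[OF True _ x(2,1), of t] True c
        by (auto simp: F_def S'_def indicator_def ennreal_mult'[symmetric] intro!: ennreal_leI)
    qed
    also have "\<dots> = ennreal c * (\<integral>\<^sup>+ t. F s t \<partial>lebesgue)"
      by (rule nn_integral_cmult) measurable
    finally show ?thesis using True by simp
  qed simp
  have "ennreal (lam * l) * ennreal l = (\<integral>\<^sup>+ s. ennreal (lam * l) * indicator I s \<partial>lebesgue)"
    by (simp add: emeasure_I nn_integral_cmult_indicator)
  also have "\<dots> \<le> (\<integral>\<^sup>+ s. ennreal c * (\<integral>\<^sup>+ t. F s t \<partial>lebesgue) \<partial>lebesgue)"
    by (intro nn_integral_mono inner_bound)
  also have "\<dots> = ennreal c * (\<integral>\<^sup>+ s. \<integral>\<^sup>+ t. F s t \<partial>lebesgue \<partial>lebesgue)"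
    by (rule nn_integral_cmult) measurable
  \<comment> \<open>Tonelli turns the iterated integral into the product integral of
    \<open>Delta\<close>.\<close>
  also have "(\<integral>\<^sup>+ s. \<integral>\<^sup>+ t. F s t \<partial>lebesgue \<partial>lebesgue)
      = (\<integral>\<^sup>+ st. F (fst st) (snd st) \<partial>(lebesgue \<Otimes>\<^sub>M lebesgue))"
    using nn_integral_fst[OF F] by (simp add: case_prod_unfold)
  also have "\<dots> = (\<integral>\<^sup>+ st \<in> I \<times> I. ennreal (spectral_norm (S (fst st) - S (snd st)) powr p)
          \<partial>(lebesgue \<Otimes>\<^sub>M lebesgue))" (is "_ = ?J")
    by (intro nn_integral_cong) (auto simp: F_def S'_def indicator_def)
  finally have le: "ennreal (lam * l) * ennreal l \<le> ennreal c * ?J" .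
  \<comment> \<open>Valid for negative \<open>lam\<close> too, where both sides are zero.\<close>
  have "ennreal lam = ennreal (1 / l\<^sup>2) * (ennreal (lam * l) * ennreal l)"
    using l by (simp add: ennreal_mult''[symmetric] ennreal_mult'[symmetric] power2_eq_square)
  also have "\<dots> \<le> ennreal (1 / l\<^sup>2) * (ennreal c * ?J)"
    by (intro mult_left_mono le) simp
  finally show ?thesis by (simp add: lam_def M_def l_def mult.left_commute)
qed

section \<open>The two bounds and their minimum\<close>

theorem proposition2p5:
  fixes I :: "real set"
    and S :: "real \<Rightarrow> real ^ 'd ^ 'd"
    and r :: nat
    and lr :: real
  assumes "is_interval I" and "bounded I" and "0 < measure lebesgue I"
    and "set_integrable lebesgue I S"
    and "1 \<le> r" and "r < CARD('d)"
    and "0 \<le> lr"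
    and "\<And>t. t \<in> I \<Longrightarrow> spd (S t)"
    and "\<And>t. t \<in> I \<Longrightarrow> rank (S t) \<le> r"
    and "\<And>t. t \<in> I \<Longrightarrow> lr \<le> eigval r (S t)"
  shows "ereal (eigval (r + 1) (interval_mean S I))
    \<le> enn2ereal (min (if lr = 0 then \<infinity> else ennreal (2 / lr) * (Delta 2 S I)\<^sup>2) (Delta 1 S I))"
proof -
  let ?lam = "eigval (r + 1) (interval_mean S I)"
  have "I \<in> sets lebesgue"
    using measurable_convex[of I] assms(1,2) by (auto simp: is_interval_convex_1)
  note le = eigval_interval_mean_le[OF this assms(3,4,6,8,9)]
  \<comment> \<open>The outer root in \<open>Delta\<close> is undone, here and for the square below;
    the value \<open>\<infinity>\<close> is preserved by the convention in
    \<open>ennreal_powr\<close>.\<close>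
  have powr1: "ennreal_powr x (1 / 1) = x" for x
    by (cases x) (auto simp: ennreal_powr_def)
  have powr_half: "(ennreal_powr x (1 / 2))\<^sup>2 = x" for x
    by (cases x) (auto simp: ennreal_powr_def ennreal_power powr_half_sqrt)
  have "ennreal ?lam \<le> ennreal 1 * Delta 1 S I"
    unfolding Delta_def powr1
    by (rule le) (simp_all add: quadratic_form_le_spectral_norm_diff(2))
  then have "ennreal ?lam \<le> Delta 1 S I" by simp
  moreover have "ennreal ?lam \<le> ennreal (2 / lr) * (Delta 2 S I)\<^sup>2" if "lr \<noteq> 0"
    unfolding Delta_def powr_half
  proof (rule le)
    show "0 \<le> 2 / lr" using assms(7) by simp
    fix s t x assume *: "s \<in> I" "t \<in> I" "norm x = 1" "S s *v x = 0"
    have lr: "0 < lr" using that assms(7) by simp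
    have "lr * (x \<bullet> (S t *v x)) \<le> (norm (S t *v x))\<^sup>2"
      using assms(5,6) * by (intro spd_quadratic_form_le[of _ r] assms(8-10)) auto
    also have "\<dots> \<le> (spectral_norm (S s - S t))\<^sup>2"
      using quadratic_form_le_spectral_norm_diff(1) * by (intro power_mono) auto
    also have "\<dots> \<le> 2 * (spectral_norm (S s - S t))\<^sup>2" by simp
    finally show "x \<bullet> (S t *v x) \<le> 2 / lr * spectral_norm (S s - S t) powr 2"
      using lr by (simp add: field_simps)
  qed
  ultimately have "ennreal ?lam \<le> min (if lr = 0 then \<infinity> else ennreal (2 / lr) * (Delta 2 S I)\<^sup>2) (Delta 1 S I)"
    by simp
  then have "enn2ereal (ennreal ?lam)
      \<le> enn2ereal (min (if lr = 0 then \<infinity> else ennreal (2 / lr) * (Delta 2 S I)\<^sup>2) (Delta 1 S I))"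
    by (simp only: less_eq_ennreal.rep_eq)
  \<comment> \<open>\<open>ennreal\<close> clips negative values to zero, which can only enlarge the
    left-hand side.\<close>
  moreover have "ereal ?lam \<le> enn2ereal (ennreal ?lam)"
    by (simp add: ennreal.rep_eq)
  ultimately show ?thesis by (rule order_trans[rotated])
qed

end
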